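(* Let $B_2(1)=\{x\in\mathbb R^2:\|x\|_2\le1\}$. For every integer $T\ge1$ and every possibly randomized online algorithm $\mathcal A$ on $B_2(1)$, there is a (fixed) sequence of continuous convex losses $f_1,\dots,f_T:B_2(1)\to[0,1]$ such that $$\mathbb E_{\mathcal A}\bigl[\mathrm{Reg}_{\mathrm{Alt}}^T\bigr]\ge\frac1{125}\left\lfloor\log_{16}T\right\rfloor ,$$ where the expectation is only over the randomness of $\mathcal A$.
   Context: A possibly randomized online algorithm $\mathcal A$ on $B_2(1)$ chooses, in each round $t\ge1$, a point $x_t\in B_2(1)$ as a (measurable) function of its internal randomness and of the past losses $f_1,\dots,f_{t-1}$. With $f_0\equiv0$, $$\mathrm{Reg}_{\mathrm{Alt}}^T=\max_{u\in B_2(1)}\sum_{t=1}^T\Bigl[f_{t-1}(x_t)+f_t(x_t)-f_{t-1}(u)-f_t(u)\Bigr].$$ *)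

theory Defs
  imports "HOL-Probability.Probability"
begin

abbreviation B2 :: "(real ^ 2) set" where
  "B2 \<equiv> cball 0 1"

(* Losses are functions on the disc only: outside B2 they carry the dummy value of
   the extensional function space, so an algorithm cannot use anything but f on B2. *)
definition losses :: "(real ^ 2 \<Rightarrow> real) set" where
  "losses = {f \<in> B2 \<rightarrow>\<^sub>E {0..1}. continuous_on B2 f \<and> convex_on B2 f}"

(* M is the internal randomness; the point of round t is A \<omega> [f 1, ..., f (t - 1)], the
   round being determined by the length of the history.  Measurability is demanded in
   \<omega> for each fixed history, which is implied by joint measurability with respect to
   any sigma-algebra on the histories. *)
definition online_algorithm ::
    "'w measure \<Rightarrow> ('w \<Rightarrow> (real ^ 2 \<Rightarrow> real) list \<Rightarrow> real ^ 2) \<Rightarrow> bool" where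
  "online_algorithm M A \<longleftrightarrow>
     prob_space M \<and>
     (\<forall>fs \<in> lists losses.
        (\<lambda>\<omega>. A \<omega> fs) \<in> borel_measurable M \<and> (\<forall>\<omega> \<in> space M. A \<omega> fs \<in> B2))"

definition plays ::
    "('w \<Rightarrow> (real ^ 2 \<Rightarrow> real) list \<Rightarrow> real ^ 2) \<Rightarrow> (nat \<Rightarrow> real ^ 2 \<Rightarrow> real) \<Rightarrow> 'w \<Rightarrow> nat \<Rightarrow> real ^ 2" where
  "plays A f \<omega> t = A \<omega> (map f [1..<t])"

(* The update implements the convention that the loss of round 0 is identically 0.
   The supremum is a maximum, see alt_regret_attained. *)
definition alt_regret ::
    "(nat \<Rightarrow> real ^ 2 \<Rightarrow> real) \<Rightarrow> (nat \<Rightarrow> real ^ 2) \<Rightarrow> nat \<Rightarrow> real" where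
  "alt_regret f x T =
     (let g = f(0 := (\<lambda>_. 0)) in
      SUP u \<in> B2. \<Sum>t = 1..T. g (t - 1) (x t) + g t (x t) - g (t - 1) u - g t u)"

lemma alt_regret_attained:
  fixes x :: "nat \<Rightarrow> real ^ 2"
  assumes f: "\<And>t. t \<in> {1..T} \<Longrightarrow> f t \<in> losses"
  defines "g \<equiv> f(0 := (\<lambda>_. 0))"
  defines "R \<equiv> \<lambda>u. \<Sum>t = 1..T. g (t - 1) (x t) + g t (x t) - g (t - 1) u - g t u"
  shows "\<exists>u \<in> B2. alt_regret f x T = R u \<and> (\<forall>v \<in> B2. R v \<le> R u)"
proof -
  have g: "continuous_on B2 (g t)" if "t \<le> T" for t
    using f[of t] that by (cases "t = 0") (auto simp: g_def losses_def)
  have "continuous_on B2 R"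
    unfolding R_def by (intro continuous_intros g) auto
  then obtain u where u: "u \<in> B2" "\<forall>v \<in> B2. R v \<le> R u"
    using continuous_attains_sup[of B2 R] by auto
  have "(SUP v \<in> B2. R v) = R u"
    using u by (intro cSup_eq_maximum) auto
  then show ?thesis
    using u by (auto simp: alt_regret_def Let_def R_def g_def)
qed

end

theory Submission
  imports Defs
begin

text \<open>
  The adversary keeps an arc of the unit circle on which all losses so far vanish, so that
  any point of the final arc is a comparator with total loss 0 and the regret is at least the
  loss of the algorithm.  A stage deals with an arc of half-width \<open>2 \<psi>\<close>, where
  \<open>\<psi> = \<pi> / 4 / 4\<^sup>k\<close>, in at most \<open>16\<^sup>k\<close> rounds.  The default loss is a wall that vanishes
  exactly on the cap cut off by the arc; it is paid by points that leave the cap, and the cap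
  is only \<open>O(\<psi>\<^sup>2)\<close> deep.  A point of the cap is penalized by one of two spikes, centred at
  the two ends of the arc and each zero on the opposite quarter of the arc.  So either the
  expected wall losses of the stage add up to a constant, or in some round one of the spikes
  costs the algorithm a constant in expectation.  In the second case the adversary plays that
  spike, which ends the stage and leaves the opposite quarter of the arc.
\<close>

section \<open>Points of the unit circle and hinge losses\<close>

definition direction :: "real \<Rightarrow> real ^ 2" where
  "direction \<phi> = vector [cos \<phi>, sin \<phi>]"

lemma direction_inner: "direction \<phi> \<bullet> direction \<psi> = cos (\<phi> - \<psi>)"
  by (simp add: direction_def inner_vec_def sum_2 cos_diff)

lemma norm_direction [simp]: "norm (direction \<phi>) = 1"
  by (simp add: norm_eq_sqrt_inner direction_inner)

lemma direction_in_B2: "direction \<phi> \<in> B2"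
  by simp

lemma direction_add_direction:
  "direction (\<phi> - \<psi>) + direction (\<phi> + \<psi>) = (2 * cos \<psi>) *\<^sub>R direction \<phi>"
  by (simp add: direction_def vec_eq_iff forall_2 cos_add cos_diff sin_add sin_diff)

text \<open>The restriction supplies the dummy value off the disc that \<open>losses\<close>
  demands.\<close>

definition hinge :: "real ^ 2 \<Rightarrow> real \<Rightarrow> real ^ 2 \<Rightarrow> real" where
  "hinge a d = restrict (\<lambda>x. max 0 (x \<bullet> a + d)) B2"

lemma hinge_eq: "x \<in> B2 \<Longrightarrow> hinge a d x = max 0 (x \<bullet> a + d)"
  by (simp add: hinge_def)

lemma hinge_in_losses:
  assumes "norm a + d \<le> 1"
  shows "hinge a d \<in> losses"
proof -
  have "x \<bullet> a + d \<le> 1" if "x \<in> B2" for x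
  proof -
    have "x \<bullet> a \<le> norm x * norm a" by (rule norm_cauchy_schwarz)
    also have "\<dots> \<le> 1 * norm a" using that by (intro mult_right_mono) auto
    finally show ?thesis using assms by simp
  qed
  then have "hinge a d \<in> B2 \<rightarrow>\<^sub>E {0..1}"
    by (auto simp: hinge_def)
  moreover have "continuous_on B2 (hinge a d)"
  proof -
    have "continuous_on B2 (\<lambda>x. max 0 (x \<bullet> a + d))" by (intro continuous_intros)
    then show ?thesis by (simp add: hinge_def cong: continuous_on_cong_simp)
  qed
  moreover have "convex_on B2 (hinge a d)"
  proof (rule convex_onI)
    fix t :: real and x y :: "real ^ 2"
    assume t: "0 < t" "t < 1" and xy: "x \<in> B2" "y \<in> B2"
    let ?z = "(1 - t) *\<^sub>R x + t *\<^sub>R y"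
    have z: "?z \<in> B2"
      using xy t by (intro convexD[OF convex_cball]) auto
    have "?z \<bullet> a + d = (1 - t) * (x \<bullet> a + d) + t * (y \<bullet> a + d)"
      by (simp add: algebra_simps)
    also have "\<dots> \<le> (1 - t) * max 0 (x \<bullet> a + d) + t * max 0 (y \<bullet> a + d)"
      using t by (intro add_mono mult_left_mono) auto
    finally show "hinge a d ?z \<le> (1 - t) * hinge a d x + t * hinge a d y"
      using t by (simp add: hinge_eq[OF z] hinge_eq[OF xy(1)] hinge_eq[OF xy(2)])
  qed (rule convex_cball)
  ultimately show ?thesis by (simp add: losses_def)
qed

text \<open>Half the distance by which a point lies outside the cap, beyond the chord through the
  directions \<phi> - 2 \<psi> and \<phi> + 2 \<psi>. The factor 1/2 keeps the value at the antipode
  at most 1.\<close>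

definition wall :: "real \<Rightarrow> real \<Rightarrow> real ^ 2 \<Rightarrow> real" where
  "wall \<phi> \<psi> = hinge (- (1 / 2) *\<^sub>R direction \<phi>) (cos (2 * \<psi>) / 2)"

text \<open>The ends of an arc of half-width 2 \<psi> are 4 \<psi> apart, so a spike at one end with
  cutoff angle 3 \<psi> spares exactly the far quarter.\<close>

definition spike :: "real \<Rightarrow> real \<Rightarrow> real ^ 2 \<Rightarrow> real" where
  "spike \<phi> \<psi> = hinge ((1 / (9 * (1 - cos \<psi>))) *\<^sub>R direction \<phi>)
                     (- cos (3 * \<psi>) / (9 * (1 - cos \<psi>)))"

lemma wall_in_losses: "wall \<phi> \<psi> \<in> losses"
  unfolding wall_def by (intro hinge_in_losses) (use cos_le_one[of "2 * \<psi>"] in \<open>simp, linarith\<close>)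

lemma cos_triple: "cos (3 * x) = 4 * cos x ^ 3 - 3 * cos (x :: real)"
  using cos_treble_cos[of x] by simp

text \<open>The peak, at \<open>direction \<phi>\<close>, is (1 - cos (3 \<psi>)) / (9 (1 - cos
  \<psi>)). The numerator factors as (1 - cos \<psi>) (2 cos \<psi> + 1)^2, and the square is at
  most 9.\<close>

lemma spike_in_losses:
  assumes "0 < \<psi>" "\<psi> \<le> pi / 4"
  shows "spike \<phi> \<psi> \<in> losses"
proof -
  define c where "c = cos \<psi>"
  have c: "0 \<le> c" "c < 1"
    using assms cos_monotone_0_pi[of 0 \<psi>] by (auto simp: c_def intro!: cos_ge_zero)
  have "1 - cos (3 * \<psi>) = (1 - c) * (2 * c + 1)\<^sup>2"
    unfolding cos_triple c_def by algebra
  also have "\<dots> \<le> (1 - c) * 3\<^sup>2"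
    using c by (intro mult_left_mono power_mono) auto
  finally have "(1 - cos (3 * \<psi>)) / (9 * (1 - c)) \<le> 1"
    using c by simp
  then show ?thesis
    using c unfolding spike_def
    by (intro hinge_in_losses) (simp add: c_def diff_divide_distrib)
qed

lemma wall_direction:
  assumes "\<bar>\<eta> - \<phi>\<bar> \<le> 2 * \<psi>" "2 * \<psi> \<le> pi"
  shows "wall \<phi> \<psi> (direction \<eta>) = 0"
proof -
  have "cos (2 * \<psi>) \<le> cos \<bar>\<eta> - \<phi>\<bar>"
    using assms by (intro cos_monotone_0_pi_le) auto
  then show ?thesis
    by (simp add: wall_def hinge_eq[OF direction_in_B2] direction_inner)
qed

lemma spike_direction:
  assumes "0 \<le> \<psi>" "3 * \<psi> \<le> \<bar>\<eta> - \<phi>\<bar>" "\<bar>\<eta> - \<phi>\<bar> \<le> pi"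
  shows "spike \<phi> \<psi> (direction \<eta>) = 0"
proof -
  have "cos \<bar>\<eta> - \<phi>\<bar> \<le> cos (3 * \<psi>)"
    using assms by (intro cos_monotone_0_pi_le) auto
  then have "(cos (\<eta> - \<phi>) - cos (3 * \<psi>)) / (9 * (1 - cos \<psi>)) \<le> 0"
    by (intro divide_nonpos_nonneg) auto
  then show ?thesis
    by (simp add: spike_def hinge_eq[OF direction_in_B2] direction_inner diff_divide_distrib)
qed

section \<open>Trigonometric estimates and the trade-off between wall and spikes\<close>

lemma one_minus_cos_quadruple: "1 - cos (4 * x) \<le> 16 * (1 - cos (x :: real))"
proof -
  \<comment> \<open>Doubling the angle at most quadruples 1 - cos; two doublings give the factor
    16.\<close>
  have *: "1 - cos (2 * y) \<le> 4 * (1 - cos y)" for y :: real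
  proof -
    have "4 * (1 - cos y) - (1 - cos (2 * y)) = 2 * (1 - cos y)\<^sup>2"
      unfolding cos_double_cos by algebra
    then show ?thesis using zero_le_power2[of "1 - cos y"] by linarith
  qed
  show ?thesis using *[of x] *[of "2 * x"] by simp
qed

text \<open>This fixes the stage length: quartering the angle shrinks 1 - cos by at most 16, so 16
  times as many rounds compensate.\<close>

lemma one_minus_cos_scaled: "1 / 4 \<le> 16 ^ k * (1 - cos (pi / 4 / 4 ^ k))"
proof (induction k)
  case 0
  have "sqrt 2 \<le> 3 / 2" by (rule real_le_lsqrt) (auto simp: power2_eq_square)
  then show ?case by (simp add: cos_45)
next
  case (Suc k)
  have "1 - cos (pi / 4 / 4 ^ k) \<le> 16 * (1 - cos (pi / 4 / 4 ^ Suc k))"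
    using one_minus_cos_quadruple[of "pi / 4 / 4 ^ Suc k"] by simp
  then have "16 ^ k * (1 - cos (pi / 4 / 4 ^ k)) \<le> 16 ^ k * (16 * (1 - cos (pi / 4 / 4 ^ Suc k)))"
    by (intro mult_left_mono) auto
  with Suc.IH show ?case by (simp only: power_Suc2 mult.assoc)
qed

text \<open>
  The sum of the two spikes is bounded below through \<open>x \<bullet> direction \<phi>\<close> alone, because their
  directions add up to a multiple of \<open>direction \<phi>\<close>.
\<close>
lemma wall_spikes_ge:
  assumes x: "x \<in> B2" and \<psi>: "0 < \<psi>" "\<psi> \<le> pi / 4"
    and N: "1 / 4 \<le> N * (1 - cos \<psi>)"
  shows "2 \<le> 9 * (spike (\<phi> - 2 * \<psi>) \<psi> x + spike (\<phi> + 2 * \<psi>) \<psi> x) + 16 * N * wall \<phi> \<psi> x"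
proof -
  define c where "c = cos \<psi>"
  define q where "q = wall \<phi> \<psi> x"
  define l where "l = x \<bullet> direction \<phi>"
  let ?S = "spike (\<phi> - 2 * \<psi>) \<psi> x + spike (\<phi> + 2 * \<psi>) \<psi> x"
  have c: "0 \<le> c" "c < 1"
    using \<psi> cos_monotone_0_pi[of 0 \<psi>] by (auto simp: c_def intro!: cos_ge_zero)
  have q: "0 \<le> q" "cos (2 * \<psi>) - l \<le> 2 * q"
    by (auto simp: q_def l_def wall_def hinge_eq[OF x] max_def field_simps)
  have c2: "0 \<le> cos (2 * \<psi>)" using \<psi> by (intro cos_ge_zero) auto
  have "x \<bullet> direction (\<phi> - 2 * \<psi>) + x \<bullet> direction (\<phi> + 2 * \<psi>) = 2 * cos (2 * \<psi>) * l"
    by (simp flip: inner_add_right add: direction_add_direction l_def)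
  moreover have "(x \<bullet> direction \<eta> - cos (3 * \<psi>)) / (9 * (1 - c)) \<le> spike \<eta> \<psi> x" for \<eta>
    by (simp add: spike_def hinge_eq[OF x] c_def diff_divide_distrib)
  then have "x \<bullet> direction \<eta> - cos (3 * \<psi>) \<le> 9 * (1 - c) * spike \<eta> \<psi> x" for \<eta>
    using c by (simp add: pos_divide_le_eq mult.commute)
  note this[of "\<phi> - 2 * \<psi>"] this[of "\<phi> + 2 * \<psi>"]
  ultimately have "2 * cos (2 * \<psi>) * l - 2 * cos (3 * \<psi>) \<le> 9 * (1 - c) * ?S"
    by (simp add: algebra_simps)
  \<comment> \<open>What the spikes lose when the point lies beyond the chord is charged to the
    wall.\<close>
  moreover have "cos (2 * \<psi>) * (cos (2 * \<psi>) - l) \<le> 2 * q"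
  proof -
    have "cos (2 * \<psi>) * (cos (2 * \<psi>) - l) \<le> cos (2 * \<psi>) * (2 * q)"
      using q c2 by (intro mult_left_mono) auto
    also have "\<dots> \<le> 1 * (2 * q)" using q by (intro mult_right_mono) auto
    finally show ?thesis by simp
  qed
  \<comment> \<open>On the chord, where l = cos (2 \<psi>), the right side is the mean of the two
    unscaled affine forms of the spikes.\<close>
  moreover have "1 - c \<le> (cos (2 * \<psi>))\<^sup>2 - cos (3 * \<psi>)"
  proof -
    have "(cos (2 * \<psi>))\<^sup>2 - cos (3 * \<psi>) = (1 - c) * (1 + 4 * c * (1 - c) * (1 + c))"
      unfolding cos_triple cos_double_cos c_def by algebra
    also have "\<dots> \<ge> (1 - c) * 1" using c by (intro mult_left_mono) auto
    finally show ?thesis by simp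
  qed
  ultimately have "2 * (1 - c) \<le> 9 * (1 - c) * ?S + 4 * q"
    by (simp add: power2_eq_square algebra_simps)
  \<comment> \<open>The assumption on N makes 1 - c a common factor, which can then be
    cancelled.\<close>
  also have "4 * q \<le> (1 - c) * (16 * N * q)"
    using mult_right_mono[OF N q(1)] by (simp add: c_def algebra_simps)
  finally have "(1 - c) * 2 \<le> (1 - c) * (9 * ?S + 16 * N * q)"
    by (simp add: algebra_simps)
  then have "2 \<le> 9 * ?S + 16 * N * q"
    using c by (simp only: mult_le_cancel_left_pos diff_gt_0_iff_gt)
  then show ?thesis by (simp only: q_def)
qed

section \<open>Expected losses along fixed histories\<close>

definition expected_loss ::
    "'w measure \<Rightarrow> ('w \<Rightarrow> (real ^ 2 \<Rightarrow> real) list \<Rightarrow> real ^ 2) \<Rightarrow>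
     (real ^ 2 \<Rightarrow> real) list \<Rightarrow> (real ^ 2 \<Rightarrow> real) \<Rightarrow> real" where
  "expected_loss M A fs f = (\<integral>\<omega>. f (A \<omega> fs) \<partial>M)"

text \<open>Each loss is charged only in its own round; the alternating terms, which charge it again
  one round later, are left out.\<close>

definition total_loss ::
    "'w measure \<Rightarrow> ('w \<Rightarrow> (real ^ 2 \<Rightarrow> real) list \<Rightarrow> real ^ 2) \<Rightarrow>
     (real ^ 2 \<Rightarrow> real) list \<Rightarrow> real" where
  "total_loss M A fs = (\<Sum>i<length fs. expected_loss M A (take i fs) (fs ! i))"

lemma total_loss_Nil [simp]: "total_loss M A [] = 0"
  by (simp add: total_loss_def)

lemma total_loss_snoc: "total_loss M A (fs @ [f]) = total_loss M A fs + expected_loss M A fs f"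
  by (simp add: total_loss_def nth_append)

lemma total_loss_replicate:
  "total_loss M A (fs @ replicate n f) =
     total_loss M A fs + (\<Sum>i<n. expected_loss M A (fs @ replicate i f) f)"
proof (induction n)
  case (Suc n)
  have "fs @ replicate (Suc n) f = (fs @ replicate n f) @ [f]"
    by (simp flip: replicate_append_same)
  then show ?case using Suc by (simp only: total_loss_snoc sum.lessThan_Suc)
qed simp

context
  fixes M :: "'w measure" and A :: "'w \<Rightarrow> (real ^ 2 \<Rightarrow> real) list \<Rightarrow> real ^ 2"
  assumes A: "online_algorithm M A"
begin

lemma online_algorithm_prob_space: "prob_space M"
  using A by (simp add: online_algorithm_def)

lemma point_in_B2: "fs \<in> lists losses \<Longrightarrow> \<omega> \<in> space M \<Longrightarrow> A \<omega> fs \<in> B2"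
  using A by (simp add: online_algorithm_def)

lemma integrable_loss:
  assumes fs: "fs \<in> lists losses" and f: "f \<in> losses"
  shows "integrable M (\<lambda>\<omega>. f (A \<omega> fs))"
proof -
  interpret prob_space M by (rule online_algorithm_prob_space)
  \<comment> \<open>Losses are continuous only on the disc, so the point is treated as a random
    element of the disc.\<close>
  have "(\<lambda>\<omega>. A \<omega> fs) \<in> measurable M (restrict_space borel B2)"
    using A fs by (intro measurable_restrict_space2) (auto simp: online_algorithm_def)
  moreover have "f \<in> borel_measurable (restrict_space borel B2)"
    using f by (intro borel_measurable_continuous_on_restrict) (simp add: losses_def)
  ultimately have "(\<lambda>\<omega>. f (A \<omega> fs)) \<in> borel_measurable M"
    by (rule measurable_compose)
  moreover have "\<bar>f (A \<omega> fs)\<bar> \<le> 1" if "\<omega> \<in> space M" for \<omega>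
    using f point_in_B2[OF fs that] by (force simp: losses_def)
  ultimately show ?thesis
    by (intro integrable_const_bound[where B = 1]) auto
qed

lemma expected_loss_nonneg:
  assumes "fs \<in> lists losses" and "f \<in> losses"
  shows "0 \<le> expected_loss M A fs f"
  unfolding expected_loss_def
  using assms point_in_B2[OF assms(1)]
  by (intro integral_nonneg_AE AE_I2) (force simp: losses_def)

lemma total_loss_replicate_ge:
  assumes "fs \<in> lists losses" and "f \<in> losses"
  shows "total_loss M A fs \<le> total_loss M A (fs @ replicate n f)"
  unfolding total_loss_replicate
  using assms by (auto intro!: sum_nonneg expected_loss_nonneg)

lemma expected_wall_spikes_ge:
  assumes fs: "fs \<in> lists losses" and \<psi>: "0 < \<psi>" "\<psi> \<le> pi / 4"
    and N: "1 / 4 \<le> N * (1 - cos \<psi>)"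
  shows "2 \<le> 9 * (expected_loss M A fs (spike (\<phi> - 2 * \<psi>) \<psi>) +
                   expected_loss M A fs (spike (\<phi> + 2 * \<psi>) \<psi>)) +
              16 * N * expected_loss M A fs (wall \<phi> \<psi>)"
proof -
  interpret prob_space M by (rule online_algorithm_prob_space)
  note int [simp] = integrable_loss[OF fs spike_in_losses[OF \<psi>]]
    integrable_loss[OF fs wall_in_losses]
  have "(\<integral>\<omega>. 2 \<partial>M) \<le> (\<integral>\<omega>. 9 * (spike (\<phi> - 2 * \<psi>) \<psi> (A \<omega> fs) + spike (\<phi> + 2 * \<psi>) \<psi> (A \<omega> fs)) +
                        16 * N * wall \<phi> \<psi> (A \<omega> fs) \<partial>M)"
    by (intro integral_mono wall_spikes_ge[OF point_in_B2[OF fs] \<psi> N]) auto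
  then show ?thesis by (simp add: expected_loss_def prob_space)
qed

section \<open>The adversary\<close>

text \<open>The point played on a history does not depend on the loss that follows, so wall and
  spikes can be compared at the same random point. The choice uses expectations only, hence the
  losses do not depend on \<omega>.\<close>

lemma stage:
  fixes k :: nat
  defines "\<psi> \<equiv> pi / 4 / 4 ^ k"
  assumes fs: "fs \<in> lists losses"
  shows "\<exists>gs \<phi>'. gs \<in> lists losses \<and> length gs \<le> 16 ^ k \<and>
           total_loss M A (fs @ gs) \<ge> total_loss M A fs + 1 / 125 \<and>
           (\<forall>\<eta>. \<bar>\<eta> - \<phi>'\<bar> \<le> \<psi> / 2 \<longrightarrow> \<bar>\<eta> - \<phi>\<bar> \<le> 2 * \<psi> \<and> (\<forall>g \<in> set gs. g (direction \<eta>) = 0))"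
proof -
  let ?Q = "wall \<phi> \<psi>" and ?hist = "\<lambda>i. fs @ replicate i (wall \<phi> \<psi>)"
  have \<psi>: "0 < \<psi>" "\<psi> \<le> pi / 4"
    unfolding \<psi>_def by (simp_all add: divide_le_eq)
  have hist: "?hist i \<in> lists losses" for i
    using fs wall_in_losses by auto
  show ?thesis
  proof (cases "(\<Sum>i<16 ^ k. expected_loss M A (?hist i) ?Q) \<ge> 1 / 125")
    case True
    \<comment> \<open>Walls spare the whole arc; keeping just its middle quarter matches the width
      left by a spike.\<close>
    have "\<bar>\<eta> - \<phi>\<bar> \<le> 2 * \<psi> \<and> (\<forall>g \<in> set (replicate (16 ^ k) ?Q). g (direction \<eta>) = 0)"
      if "\<bar>\<eta> - \<phi>\<bar> \<le> \<psi> / 2" for \<eta>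
      using that \<psi> by (auto intro!: wall_direction)
    then show ?thesis
      using True wall_in_losses
      by (intro exI[of _ "replicate (16 ^ k) ?Q"] exI[of _ \<phi>]) (auto simp: total_loss_replicate)
  next
    case False
    \<comment> \<open>By averaging, some round costs less than its share; there a spike replaces the
      wall.\<close>
    have "\<exists>i<16 ^ k. 16 ^ k * expected_loss M A (?hist i) ?Q < 1 / 125"
    proof (rule ccontr)
      assume none: "\<not> ?thesis"
      then have "1 / 125 / 16 ^ k \<le> expected_loss M A (?hist i) ?Q" if "i < 16 ^ k" for i
      proof -
        have "1 / 125 \<le> 16 ^ k * expected_loss M A (?hist i) ?Q"
          using none that not_less by blast
        then show ?thesis by (simp add: divide_le_eq ac_simps)
      qed
      then have "(\<Sum>i<(16 :: nat) ^ k. 1 / 125 / 16 ^ k) \<le> (\<Sum>i<16 ^ k. expected_loss M A (?hist i) ?Q)"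
        by (intro sum_mono) auto
      with False show False by simp
    qed
    then obtain i where i: "i < 16 ^ k" "16 ^ k * expected_loss M A (?hist i) ?Q < 1 / 125"
      by blast
    have "2 \<le> 9 * (expected_loss M A (?hist i) (spike (\<phi> - 2 * \<psi>) \<psi>) +
                   expected_loss M A (?hist i) (spike (\<phi> + 2 * \<psi>) \<psi>)) +
              16 * 16 ^ k * expected_loss M A (?hist i) ?Q"
      by (intro expected_wall_spikes_ge hist \<psi>) (unfold \<psi>_def, rule one_minus_cos_scaled)
    \<comment> \<open>If both spikes cost less than 1/125, the right side would be below (9 + 9 +
      16) / 125 < 2.\<close>
    then have "1 / 125 \<le> expected_loss M A (?hist i) (spike (\<phi> - 2 * \<psi>) \<psi>) \<or>
               1 / 125 \<le> expected_loss M A (?hist i) (spike (\<phi> + 2 * \<psi>) \<psi>)"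
      using i(2) unfolding mult.assoc by argo
    then obtain s :: real where s: "s = 1 \<or> s = - 1"
      and loss: "1 / 125 \<le> expected_loss M A (?hist i) (spike (\<phi> - s * 2 * \<psi>) \<psi>)"
      by (metis diff_minus_eq_add mult_1 mult_minus1 mult_minus_left)
    let ?R = "spike (\<phi> - s * 2 * \<psi>) \<psi>"
    define gs where "gs = replicate i ?Q @ [?R]"
    have "total_loss M A (fs @ gs) = total_loss M A (?hist i) + expected_loss M A (?hist i) ?R"
      by (simp add: gs_def total_loss_snoc flip: append_assoc)
    then have "total_loss M A (fs @ gs) \<ge> total_loss M A fs + 1 / 125"
      using loss total_loss_replicate_ge[OF fs wall_in_losses, of i \<phi> \<psi>] by linarith
    moreover have "gs \<in> lists losses"
      using wall_in_losses spike_in_losses[OF \<psi>] by (auto simp: gs_def)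
    moreover have "length gs \<le> 16 ^ k"
      using i(1) by (simp add: gs_def)
    moreover have "\<bar>\<eta> - \<phi>\<bar> \<le> 2 * \<psi> \<and> (\<forall>g \<in> set gs. g (direction \<eta>) = 0)"
      if "\<bar>\<eta> - (\<phi> + s * 3 / 2 * \<psi>)\<bar> \<le> \<psi> / 2" for \<eta>
    proof -
      \<comment> \<open>The new arc runs from \<phi> + s \<psi> to \<phi> + 2 s \<psi>. The bound 4
        \<psi> \<le> \<pi> keeps the angle where cosine is monotone.\<close>
      have \<eta>: "\<bar>\<eta> - \<phi>\<bar> \<le> 2 * \<psi>" "3 * \<psi> \<le> \<bar>\<eta> - (\<phi> - s * 2 * \<psi>)\<bar>" "\<bar>\<eta> - (\<phi> - s * 2 * \<psi>)\<bar> \<le> 4 * \<psi>"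
        using that s \<psi> by (auto simp: abs_if split: if_splits)
      have "wall \<phi> \<psi> (direction \<eta>) = 0" "?R (direction \<eta>) = 0"
        using \<eta> \<psi> by (auto intro!: wall_direction spike_direction)
      with \<eta> show ?thesis by (auto simp: gs_def)
    qed
    ultimately show ?thesis by blast
  qed
qed

text \<open>Each step appends one stage: 16^k + 16^k \<le> 16^(k+1) bounds the rounds, and the
  half-width \<psi>/2 left by the stage is twice the next \<psi>.\<close>

lemma lossless_angles:
  "\<exists>fs \<phi>. fs \<in> lists losses \<and> length fs \<le> 16 ^ k \<and> total_loss M A fs \<ge> real k / 125 \<and>
     (\<forall>\<eta>. \<bar>\<eta> - \<phi>\<bar> \<le> 2 * (pi / 4 / 4 ^ k) \<longrightarrow> (\<forall>f \<in> set fs. f (direction \<eta>) = 0))"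
proof (induction k)
  case 0
  show ?case by (intro exI[of _ "[]"]) simp
next
  case (Suc k)
  then obtain fs \<phi> where fs: "fs \<in> lists losses" "length fs \<le> 16 ^ k"
      "total_loss M A fs \<ge> real k / 125"
      "\<And>\<eta> f. \<bar>\<eta> - \<phi>\<bar> \<le> 2 * (pi / 4 / 4 ^ k) \<Longrightarrow> f \<in> set fs \<Longrightarrow> f (direction \<eta>) = 0"
    by blast
  obtain gs \<phi>' where gs: "gs \<in> lists losses" "length gs \<le> 16 ^ k"
      "total_loss M A (fs @ gs) \<ge> total_loss M A fs + 1 / 125"
      "\<And>\<eta>. \<bar>\<eta> - \<phi>'\<bar> \<le> pi / 4 / 4 ^ k / 2 \<Longrightarrow>
         \<bar>\<eta> - \<phi>\<bar> \<le> 2 * (pi / 4 / 4 ^ k) \<and> (\<forall>g \<in> set gs. g (direction \<eta>) = 0)"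
    using stage[OF fs(1), of k \<phi>] by blast
  have "\<forall>f \<in> set (fs @ gs). f (direction \<eta>) = 0" if "\<bar>\<eta> - \<phi>'\<bar> \<le> 2 * (pi / 4 / 4 ^ Suc k)" for \<eta>
  proof -
    have "\<bar>\<eta> - \<phi>'\<bar> \<le> pi / 4 / 4 ^ k / 2" using that by simp
    from gs(4)[OF this] fs(4) show ?thesis by auto
  qed
  moreover have "length (fs @ gs) \<le> 16 ^ Suc k"
    using fs(2) gs(2) by simp
  moreover have "total_loss M A (fs @ gs) \<ge> real (Suc k) / 125"
    using fs(3) gs(3) by (simp add: add_divide_distrib)
  ultimately show ?case
    using fs(1) gs(1) by (intro exI[of _ "fs @ gs"] exI[of _ \<phi>']) auto
qed

section \<open>From total loss to alternating regret\<close>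

text \<open>Since losses are nonnegative, a common zero u attains the supremum, and the regret is
  the algorithm's own loss. Dropping its nonnegative alternating terms leaves
  \<open>total_loss\<close>.\<close>

lemma expected_alt_regret_ge_total_loss:
  assumes fs: "fs \<in> lists losses" and u: "u \<in> B2" "\<And>f. f \<in> set fs \<Longrightarrow> f u = 0"
  defines "f \<equiv> \<lambda>t. fs ! (t - 1)"
  shows "(\<integral>\<omega>. alt_regret f (plays A f \<omega>) (length fs) \<partial>M) \<ge> total_loss M A fs"
proof -
  interpret prob_space M by (rule online_algorithm_prob_space)
  define T where "T = length fs"
  \<comment> \<open>By truncated subtraction \<open>f 0\<close> is \<open>fs ! 0\<close>; the update
    installs the zero loss of round 0.\<close>
  define g where "g = f(0 := (\<lambda>_. 0))"
  define x where "x = plays A f"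
  have loss: "f t \<in> losses" if "t \<in> {1..T}" for t
    using that fs by (auto simp: f_def T_def in_lists_conv_set)
  have hist: "map f [1..<t] = take (t - 1) fs" if "t \<in> {1..T}" for t
    using that by (intro nth_equalityI) (auto simp: f_def T_def)
  have take: "take i fs \<in> lists losses" for i
    using fs by (auto simp: in_lists_conv_set dest: in_set_takeD)
  have x: "x \<omega> t = A \<omega> (take (t - 1) fs)" if "t \<in> {1..T}" for \<omega> t
    using hist[OF that] by (simp add: x_def plays_def)
  have xB: "x \<omega> t \<in> B2" if "t \<in> {1..T}" "\<omega> \<in> space M" for \<omega> t
    using that by (simp add: x del: mem_cball_0 mem_cball point_in_B2[OF take])
      (rule point_in_B2[OF take])
  have g_nonneg: "0 \<le> g t v" if "t \<le> T" "v \<in> B2" for t v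
    using loss[of t] that by (cases "t = 0") (force simp: g_def losses_def)+
  have g_u: "g t u = 0" if "t \<le> T" for t
    using u(2)[of "f t"] that by (cases "t = 0") (auto simp: g_def f_def T_def)
  have regret: "alt_regret f y T = (\<Sum>t = 1..T. g (t - 1) (y t) + g t (y t))" for y
  proof -
    let ?S = "\<lambda>v. \<Sum>t = 1..T. g (t - 1) (y t) + g t (y t) - g (t - 1) v - g t v"
    have "?S v \<le> ?S u" if "v \<in> B2" for v
    proof (intro sum_mono)
      fix t assume "t \<in> {1..T}"
      then show "g (t - 1) (y t) + g t (y t) - g (t - 1) v - g t v
                 \<le> g (t - 1) (y t) + g t (y t) - g (t - 1) u - g t u"
        using g_nonneg[of t v] g_nonneg[of "t - 1" v] g_u[of t] g_u[of "t - 1"] that by force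
    qed
    then have "(SUP v \<in> B2. ?S v) = ?S u"
      using u(1) by (intro cSup_eq_maximum) auto
    also have "\<dots> = (\<Sum>t = 1..T. g (t - 1) (y t) + g t (y t))"
      using g_u by (intro sum.cong) auto
    finally show ?thesis by (simp add: alt_regret_def Let_def g_def)
  qed
  have int: "integrable M (\<lambda>\<omega>. g s (x \<omega> t))" if "s \<le> T" "t \<in> {1..T}" for s t
    using integrable_loss[OF take loss] that by (cases "s = 0") (auto simp: g_def x)
  have "total_loss M A fs = (\<Sum>t = 1..T. expected_loss M A (take (t - 1) fs) (f t))"
    unfolding total_loss_def T_def f_def
    by (rule sum.reindex_bij_witness[of _ "\<lambda>t. t - 1" Suc]) auto
  also have "\<dots> = (\<Sum>t = 1..T. \<integral>\<omega>. g t (x \<omega> t) \<partial>M)"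
    by (intro sum.cong) (auto simp: expected_loss_def g_def x)
  also have "\<dots> \<le> (\<Sum>t = 1..T. \<integral>\<omega>. g (t - 1) (x \<omega> t) + g t (x \<omega> t) \<partial>M)"
    using int by (intro sum_mono integral_mono) (auto intro!: g_nonneg xB simp del: mem_cball_0 mem_cball)
  also have "\<dots> = (\<integral>\<omega>. alt_regret f (x \<omega>) T \<partial>M)"
    unfolding regret using int by (subst Bochner_Integration.integral_sum) auto
  finally show ?thesis by (simp add: x_def T_def)
qed

end

theorem theorem9:
  fixes T :: nat
    and M :: "'w measure"
    and A :: "'w \<Rightarrow> (real ^ 2 \<Rightarrow> real) list \<Rightarrow> real ^ 2"
  assumes "T \<ge> 1"
    and "online_algorithm M A"
  shows "\<exists>f :: nat \<Rightarrow> real ^ 2 \<Rightarrow> real.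
           (\<forall>t \<in> {1..T}. f t \<in> losses) \<and>
           (\<integral>\<omega>. alt_regret f (plays A f \<omega>) T \<partial>M) \<ge> 1 / 125 * real_of_int \<lfloor>log 16 (real T)\<rfloor>"
proof -
  define k where "k = nat \<lfloor>log 16 (real T)\<rfloor>"
  have "0 \<le> log 16 (real T)" using assms(1) by simp
  then have k: "real_of_int \<lfloor>log 16 (real T)\<rfloor> = real k" by (simp add: k_def)
  then have "16 powr real k \<le> real T"
    using assms(1) of_int_floor_le[of "log 16 (real T)"] by (simp add: le_log_iff)
  then have "real (16 ^ k) \<le> real T" by (simp add: powr_realpow)
  then have kT: "16 ^ k \<le> T" by (simp only: of_nat_le_iff)
  obtain fs \<phi> where fs: "fs \<in> lists losses" "length fs \<le> 16 ^ k" "total_loss M A fs \<ge> real k / 125"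
      "\<forall>f \<in> set fs. f (direction \<phi>) = 0"
    using lossless_angles[OF assms(2), of k]
    by (metis abs_zero diff_self mult_nonneg_nonneg pi_ge_zero divide_nonneg_nonneg zero_le_numeral zero_le_power)
  \<comment> \<open>The zero loss, as an extensional function, pads the sequence to T rounds: the
    comparator still pays nothing and the total loss does not drop.\<close>
  let ?zero = "hinge 0 0"
  have zero: "?zero \<in> losses" by (rule hinge_in_losses) simp
  define gs where "gs = fs @ replicate (T - length fs) ?zero"
  have len: "length gs = T" using fs(2) kT by (simp add: gs_def)
  have gs: "gs \<in> lists losses" using fs(1) zero by (auto simp: gs_def)
  have "real k / 125 \<le> total_loss M A gs"
    unfolding gs_def using fs(3) total_loss_replicate_ge[OF assms(2) fs(1) zero] by (rule order_trans)
  also have "\<dots> \<le> (\<integral>\<omega>. alt_regret (\<lambda>t. gs ! (t - 1)) (plays A (\<lambda>t. gs ! (t - 1)) \<omega>) T \<partial>M)"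
    unfolding len[symmetric] using fs(4)
    by (intro expected_alt_regret_ge_total_loss[OF assms(2) gs direction_in_B2[of \<phi>]])
      (auto simp: gs_def hinge_def)
  finally show ?thesis
    using gs len by (intro exI[of _ "\<lambda>t. gs ! (t - 1)"]) (auto simp: k in_lists_conv_set)
qed

end
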